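(* Consider the system of recurrences $$x_{n+4}x_n = \alpha^{(0)} x_{n+3}x_{n+1}+\beta^{(0)} x_{n+2}^2,$$ $$x_n y_{n+4} - \alpha^{(0)} x_{n+1}y_{n+3}-2\beta^{(0)}x_{n+2}y_{n+2} - \alpha^{(0)} x_{n+3}y_{n+1} +x_{n+4}y_n = \alpha^{(1)} x_{n+1}x_{n+3} +\beta^{(1)} x_{n+2}^2,$$ for all $n\in\mathbb{Z}$, where the coefficients $\alpha^{(0)},\alpha^{(1)},\beta^{(0)},\beta^{(1)}$ and the initial data $x_0,x_1,x_2,x_3,y_0,y_1,y_2,y_3$ are regarded as independent indeterminates, and the iterates $x_n,y_n$ for all $n\in\mathbb{Z}$ are determined by running the recurrences forwards and backwards. This system has the Laurent property, in the sense that for all $n\in\mathbb{Z}$, $$x_n\in \mathbb{Z}[\alpha^{(0)},\beta^{(0)},x_0^{\pm 1},x_1^{\pm 1},x_2^{\pm 1},x_3^{\pm 1}]$$ and $$y_n\in \mathbb{Z}[\alpha^{(0)},\alpha^{(1)},\beta^{(0)},\beta^{(1)},x_0^{\pm 1},x_1^{\pm 1},x_2^{\pm 1},x_3^{\pm 1},y_0,y_1,y_2,y_3].$$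
   Context: The system is the pair of even/odd components of the Somos-4 recurrence $X_{n+4}X_n = (\alpha^{(0)}+\alpha^{(1)}\varepsilon)X_{n+3}X_{n+1}+(\beta^{(0)}+\beta^{(1)}\varepsilon)X_{n+2}^2$ for dual numbers $X_n=x_n+y_n\varepsilon$ with $\varepsilon^2=0$. The notation $R[a^{\pm1},\dots]$ denotes Laurent polynomials in $a,\dots$ over the ring $R$. *)

theory Defs
  imports "HOL-Library.Poly_Mapping" "HOL-Computational_Algebra.Fraction_Field"
begin

datatype indet =
    Alpha0 | Alpha1 | Beta0 | Beta1
  | X0 | X1 | X2 | X3
  | Y0 | Y1 | Y2 | Y3

text \<open>
  The linear order on the indeterminates has no mathematical meaning; it is only needed
  because the integral domain instance of \<^typ>\<open>('a, 'b) poly_mapping\<close> asks for linearly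
  ordered exponents.
\<close>

fun indet_rank :: "indet \<Rightarrow> nat" where
  "indet_rank Alpha0 = 0" | "indet_rank Alpha1 = 1"
| "indet_rank Beta0 = 2" | "indet_rank Beta1 = 3"
| "indet_rank X0 = 4" | "indet_rank X1 = 5" | "indet_rank X2 = 6" | "indet_rank X3 = 7"
| "indet_rank Y0 = 8" | "indet_rank Y1 = 9" | "indet_rank Y2 = 10" | "indet_rank Y3 = 11"

lemma indet_rank_inject: "indet_rank a = indet_rank b \<Longrightarrow> a = b"
  by (cases a; cases b; simp)

instantiation indet :: linorder
begin

definition less_eq_indet :: "indet \<Rightarrow> indet \<Rightarrow> bool" where
  "a \<le> b \<longleftrightarrow> indet_rank a \<le> indet_rank b"

definition less_indet :: "indet \<Rightarrow> indet \<Rightarrow> bool" where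
  "a < b \<longleftrightarrow> indet_rank a < indet_rank b"

instance
  by standard (auto simp: less_eq_indet_def less_indet_def intro: indet_rank_inject)

end

text \<open>
  Integer polynomials in the twelve indeterminates (a monomial is a finitely supported
  exponent vector), and their field of fractions, in which the iterates live.
\<close>

type_synonym int_mpoly = "(indet \<Rightarrow>\<^sub>0 nat) \<Rightarrow>\<^sub>0 int"
type_synonym ratfun = "int_mpoly fract"

definition var :: "indet \<Rightarrow> ratfun" where
  "var v = Fract (Poly_Mapping.single (Poly_Mapping.single v 1) 1) 1"

text \<open>
  The subring \<open>\<int>[S]\<close> generated by \<open>S\<close>.
\<close>

inductive_set int_adjoin :: "'a::comm_ring_1 set \<Rightarrow> 'a set" for S :: "'a set" where
  gen: "s \<in> S \<Longrightarrow> s \<in> int_adjoin S"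
| one: "1 \<in> int_adjoin S"
| diff: "a \<in> int_adjoin S \<Longrightarrow> b \<in> int_adjoin S \<Longrightarrow> a - b \<in> int_adjoin S"
| mult: "a \<in> int_adjoin S \<Longrightarrow> b \<in> int_adjoin S \<Longrightarrow> a * b \<in> int_adjoin S"

text \<open>
  \<open>\<int>[S, T\<^sup>\<plusminus>\<^sup>1]\<close>: polynomial in the elements of \<open>S\<close>, Laurent polynomial in those of \<open>T\<close>.
\<close>

definition int_laurent :: "'a::field set \<Rightarrow> 'a set \<Rightarrow> 'a set" where
  "int_laurent S T = int_adjoin (S \<union> T \<union> inverse ` T)"

definition dual_somos4 ::
  "'a \<Rightarrow> 'a \<Rightarrow> 'a \<Rightarrow> 'a \<Rightarrow> (int \<Rightarrow> 'a::field) \<Rightarrow> (int \<Rightarrow> 'a) \<Rightarrow> bool" where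
  "dual_somos4 a0 a1 b0 b1 x y \<longleftrightarrow>
    (\<forall>n. x (n + 4) * x n = a0 * x (n + 3) * x (n + 1) + b0 * (x (n + 2))\<^sup>2) \<and>
    (\<forall>n. x n * y (n + 4) - a0 * x (n + 1) * y (n + 3) - 2 * b0 * x (n + 2) * y (n + 2)
           - a0 * x (n + 3) * y (n + 1) + x (n + 4) * y n
         = a1 * x (n + 1) * x (n + 3) + b1 * (x (n + 2))\<^sup>2)"

text \<open>
  Sequences solving the system with the indeterminates as coefficients and initial data.
  The lemma \<open>dual_somos4_iterates_ex1\<close> below shows that there is exactly one such pair,
  i.e. that running the recurrences forwards and backwards never divides by zero.
\<close>

definition dual_somos4_iterates :: "(int \<Rightarrow> ratfun) \<Rightarrow> (int \<Rightarrow> ratfun) \<Rightarrow> bool" where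
  "dual_somos4_iterates x y \<longleftrightarrow>
    dual_somos4 (var Alpha0) (var Alpha1) (var Beta0) (var Beta1) x y \<and>
    x 0 = var X0 \<and> x 1 = var X1 \<and> x 2 = var X2 \<and> x 3 = var X3 \<and>
    y 0 = var Y0 \<and> y 1 = var Y1 \<and> y 2 = var Y2 \<and> y 3 = var Y3"

text \<open>
  Nonzero polynomials with nonnegative coefficients; quotients of these are closed under
  addition, multiplication and division, and are nonzero.
\<close>

definition pos_poly :: "int_mpoly \<Rightarrow> bool" where
  "pos_poly p \<longleftrightarrow> p \<noteq> 0 \<and> (\<forall>k. 0 \<le> Poly_Mapping.lookup p k)"

definition pos_ratfun :: "ratfun \<Rightarrow> bool" where
  "pos_ratfun f \<longleftrightarrow> (\<exists>p q. pos_poly p \<and> pos_poly q \<and> f = Fract p q)"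

lemma pos_poly_add:
  assumes "pos_poly p" "pos_poly q"
  shows "pos_poly (p + q)"
proof -
  obtain k where "Poly_Mapping.lookup p k \<noteq> 0"
    using assms(1) unfolding pos_poly_def by (metis lookup_zero poly_mapping_eqI)
  moreover have nonneg: "0 \<le> Poly_Mapping.lookup p l" "0 \<le> Poly_Mapping.lookup q l" for l
    using assms by (simp_all add: pos_poly_def)
  ultimately have "Poly_Mapping.lookup (p + q) k \<noteq> 0"
    by (simp add: lookup_add add_nonneg_eq_0_iff)
  then have "p + q \<noteq> 0" by (metis lookup_zero)
  then show ?thesis by (simp add: pos_poly_def lookup_add nonneg)
qed

lemma pos_poly_mult:
  assumes "pos_poly p" "pos_poly q"
  shows "pos_poly (p * q)"
proof -
  have "0 \<le> Poly_Mapping.lookup (p * q) k" for k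
    using assms unfolding pos_poly_def times_poly_mapping.rep_eq prod_fun_def Sum_any.expand_set
    by (auto intro!: sum_nonneg mult_nonneg_nonneg simp: when_def)
  then show ?thesis
    using assms by (auto simp: pos_poly_def)
qed

lemma pos_poly_single: "pos_poly (Poly_Mapping.single k 1)"
  unfolding pos_poly_def
  by (auto simp: lookup_single when_def)

lemma pos_poly_one: "pos_poly 1"
  using pos_poly_single[of 0] by simp

lemma pos_ratfun_var: "pos_ratfun (var v)"
  unfolding pos_ratfun_def var_def
  by (intro exI conjI; (rule refl)?) (rule pos_poly_single pos_poly_one)+

lemma pos_ratfun_nonzero:
  assumes "pos_ratfun f"
  shows "f \<noteq> 0"
proof -
  obtain p q where "p \<noteq> 0" "q \<noteq> 0" "f = Fract p q"
    using assms unfolding pos_ratfun_def pos_poly_def by blast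
  then show ?thesis
    unfolding Zero_fract_def by (simp add: eq_fract(1) del: fract_collapse)
qed

lemma pos_ratfun_add:
  assumes "pos_ratfun f" "pos_ratfun g"
  shows "pos_ratfun (f + g)"
proof -
  obtain a b c d where *: "pos_poly a" "pos_poly b" "pos_poly c" "pos_poly d"
    and fg: "f = Fract a b" "g = Fract c d"
    using assms unfolding pos_ratfun_def by blast
  have "f + g = Fract (a * d + c * b) (b * d)"
    unfolding fg by (rule add_fract) (use * in \<open>simp_all add: pos_poly_def\<close>)
  then show ?thesis
    unfolding pos_ratfun_def
    by (intro exI[of _ "a * d + c * b"] exI[of _ "b * d"]) (simp add: * pos_poly_add pos_poly_mult)
qed

lemma pos_ratfun_mult:
  assumes "pos_ratfun f" "pos_ratfun g"
  shows "pos_ratfun (f * g)"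
proof -
  obtain a b c d where "pos_poly a" "pos_poly b" "pos_poly c" "pos_poly d"
    and "f = Fract a b" "g = Fract c d"
    using assms unfolding pos_ratfun_def by blast
  then show ?thesis
    unfolding pos_ratfun_def
    by (intro exI[of _ "a * c"] exI[of _ "b * d"]) (simp add: pos_poly_mult)
qed

lemma pos_ratfun_divide:
  assumes "pos_ratfun f" "pos_ratfun g"
  shows "pos_ratfun (f / g)"
proof -
  obtain a b c d where "pos_poly a" "pos_poly b" "pos_poly c" "pos_poly d"
    and "f = Fract a b" "g = Fract c d"
    using assms unfolding pos_ratfun_def by blast
  then show ?thesis
    unfolding pos_ratfun_def
    by (intro exI[of _ "a * d"] exI[of _ "b * c"]) (simp add: pos_poly_mult)
qed

lemmas pos_ratfun_intros =
  pos_ratfun_var pos_ratfun_add pos_ratfun_mult pos_ratfun_divide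

text \<open>
  Four consecutive terms of each sequence, and one forward or backward step.
\<close>

type_synonym window = "(ratfun \<times> ratfun \<times> ratfun \<times> ratfun) \<times> (ratfun \<times> ratfun \<times> ratfun \<times> ratfun)"

fun fwd :: "window \<Rightarrow> window" where
  "fwd ((p, q, r, s), (p', q', r', s')) =
    (let t = (var Alpha0 * s * q + var Beta0 * r\<^sup>2) / p
     in ((q, r, s, t),
         (q', r', s', (var Alpha1 * q * s + var Beta1 * r\<^sup>2 + var Alpha0 * q * s'
             + 2 * var Beta0 * r * r' + var Alpha0 * s * q' - t * p') / p)))"

fun bwd :: "window \<Rightarrow> window" where
  "bwd ((q, r, s, t), (q', r', s', t')) =
    (let p = (var Alpha0 * s * q + var Beta0 * r\<^sup>2) / t
     in ((p, q, r, s),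
         ((var Alpha1 * q * s + var Beta1 * r\<^sup>2 + var Alpha0 * q * s'
             + 2 * var Beta0 * r * r' + var Alpha0 * s * q' - p * t') / t, q', r', s')))"

fun pos_window :: "window \<Rightarrow> bool" where
  "pos_window ((p, q, r, s), _) \<longleftrightarrow> pos_ratfun p \<and> pos_ratfun q \<and> pos_ratfun r \<and> pos_ratfun s"

lemma fwd_shift:
  "fst (fst (fwd w)) = fst (snd (fst w))"
  "fst (snd (fst (fwd w))) = fst (snd (snd (fst w)))"
  "fst (snd (snd (fst (fwd w)))) = snd (snd (snd (fst w)))"
  "fst (snd (fwd w)) = fst (snd (snd w))"
  "fst (snd (snd (fwd w))) = fst (snd (snd (snd w)))"
  "fst (snd (snd (snd (fwd w)))) = snd (snd (snd (snd w)))"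
  by (cases w rule: fwd.cases, simp add: Let_def)+

lemma pos_window_fwd: "pos_window w \<Longrightarrow> pos_window (fwd w)"
  by (cases w rule: fwd.cases) (auto simp: Let_def power2_eq_square intro!: pos_ratfun_intros)

lemma pos_window_bwd: "pos_window w \<Longrightarrow> pos_window (bwd w)"
  by (cases w rule: bwd.cases) (auto simp: Let_def power2_eq_square intro!: pos_ratfun_intros)

lemma fwd_bwd:
  assumes "pos_window w"
  shows "fwd (bwd w) = w"
proof (cases w rule: bwd.cases)
  case (1 q r s t q' r' s' t')
  let ?p = "(var Alpha0 * s * q + var Beta0 * r\<^sup>2)"
  have "pos_ratfun ?p" "t \<noteq> 0"
    using assms 1 by (auto simp: power2_eq_square intro!: pos_ratfun_intros pos_ratfun_nonzero)
  then have "?p \<noteq> 0" by (simp add: pos_ratfun_nonzero)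
  then show ?thesis
    using \<open>t \<noteq> 0\<close> unfolding 1 by (simp add: Let_def)
qed

definition start :: window where
  "start = ((var X0, var X1, var X2, var X3), (var Y0, var Y1, var Y2, var Y3))"

definition orbit :: "int \<Rightarrow> window" where
  "orbit n = (if 0 \<le> n then (fwd ^^ nat n) start else (bwd ^^ nat (- n)) start)"

lemma pos_window_orbit: "pos_window (orbit n)"
proof -
  have "pos_window start" by (simp add: start_def pos_ratfun_var)
  then have "pos_window ((fwd ^^ k) start)" "pos_window ((bwd ^^ k) start)" for k
    by (induction k) (simp_all add: pos_window_fwd pos_window_bwd)
  then show ?thesis by (simp add: orbit_def)
qed

lemma orbit_step: "orbit (n + 1) = fwd (orbit n)"
proof (cases "0 \<le> n")
  case True
  then show ?thesis by (simp add: orbit_def nat_add_distrib)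
next
  case False
  have bwd_step: "orbit n = bwd (orbit (n + 1))"
  proof -
    have "nat (- n) = Suc (nat (- (n + 1)))" using False by simp
    then show ?thesis using False by (cases "n = -1") (simp_all add: orbit_def)
  qed
  show ?thesis by (simp add: bwd_step fwd_bwd pos_window_orbit)
qed

definition window_of :: "(int \<Rightarrow> ratfun) \<Rightarrow> (int \<Rightarrow> ratfun) \<Rightarrow> int \<Rightarrow> window" where
  "window_of x y n = ((x n, x (n+1), x (n+2), x (n+3)), (y n, y (n+1), y (n+2), y (n+3)))"

lemma window_of_step:
  assumes "dual_somos4 (var Alpha0) (var Alpha1) (var Beta0) (var Beta1) x y"
  shows "x n \<noteq> 0 \<Longrightarrow> window_of x y (n + 1) = fwd (window_of x y n)"
    and "x (n + 4) \<noteq> 0 \<Longrightarrow> window_of x y n = bwd (window_of x y (n + 1))"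
proof -
  have 1: "x (n + 4) * x n = var Alpha0 * x (n + 3) * x (n + 1) + var Beta0 * (x (n + 2))\<^sup>2"
    and 2: "x n * y (n + 4) - var Alpha0 * x (n + 1) * y (n + 3)
        - 2 * var Beta0 * x (n + 2) * y (n + 2)
        - var Alpha0 * x (n + 3) * y (n + 1) + x (n + 4) * y n
      = var Alpha1 * x (n + 1) * x (n + 3) + var Beta1 * (x (n + 2))\<^sup>2"
    using assms unfolding dual_somos4_def by blast+
  have e: "n + 1 + 1 = n + 2" "n + 1 + 2 = n + 3" "n + 1 + 3 = n + 4" by simp_all
  have 3: "var Alpha1 * x (n + 1) * x (n + 3) + var Beta1 * (x (n + 2))\<^sup>2
      + var Alpha0 * x (n + 1) * y (n + 3) + 2 * var Beta0 * x (n + 2) * y (n + 2)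
      + var Alpha0 * x (n + 3) * y (n + 1) = x n * y (n + 4) + x (n + 4) * y n"
    using 2 by (simp add: algebra_simps)
  show "window_of x y (n + 1) = fwd (window_of x y n)" if "x n \<noteq> 0"
    using that by (simp add: window_of_def e Let_def 1[symmetric] 3)
  show "window_of x y n = bwd (window_of x y (n + 1))" if "x (n + 4) \<noteq> 0"
    using that by (simp add: window_of_def e Let_def 1[symmetric] 3)
qed

lemma bwd_fwd:
  assumes "pos_window w"
  shows "bwd (fwd w) = w"
proof (cases w rule: fwd.cases)
  case (1 p q r s p' q' r' s')
  let ?t = "(var Alpha0 * s * q + var Beta0 * r\<^sup>2)"
  have "pos_ratfun ?t" "p \<noteq> 0"
    using assms 1 by (auto simp: power2_eq_square intro!: pos_ratfun_intros pos_ratfun_nonzero)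
  then have "?t \<noteq> 0" by (simp add: pos_ratfun_nonzero)
  then show ?thesis
    using \<open>p \<noteq> 0\<close> unfolding 1 by (simp add: Let_def)
qed

lemma window_of_eq_orbit:
  assumes "dual_somos4_iterates x y"
  shows "window_of x y n = orbit n"
proof (induction n rule: int_induct[where k = 0])
  case base
  show ?case
    using assms by (simp add: dual_somos4_iterates_def window_of_def orbit_def start_def)
next
  case (step1 n)
  have "x n \<noteq> 0"
    using pos_window_orbit[of n] unfolding step1.IH[symmetric]
    by (simp add: window_of_def pos_ratfun_nonzero)
  moreover have "dual_somos4 (var Alpha0) (var Alpha1) (var Beta0) (var Beta1) x y"
    using assms unfolding dual_somos4_iterates_def by blast
  ultimately show ?case
    using step1.IH window_of_step(1)[of x y n] by (metis orbit_step)
next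
  case (step2 n)
  have "x (n - 1 + 4) \<noteq> 0"
    using pos_window_orbit[of n] unfolding step2.IH[symmetric]
    by (simp add: window_of_def pos_ratfun_nonzero add.commute)
  moreover have "dual_somos4 (var Alpha0) (var Alpha1) (var Beta0) (var Beta1) x y"
    using assms unfolding dual_somos4_iterates_def by blast
  ultimately have "window_of x y (n - 1) = bwd (orbit n)"
    using window_of_step(2)[of x y "n - 1"] step2.IH by (metis diff_add_cancel)
  also have "orbit n = fwd (orbit (n - 1))"
    using orbit_step[of "n - 1"] by simp
  finally show ?case by (simp add: bwd_fwd pos_window_orbit)
qed

lemma dual_somos4_iterates_ex:
  "dual_somos4_iterates (\<lambda>n. fst (fst (orbit n))) (\<lambda>n. fst (snd (orbit n)))"
proof -
  define x y where "x = (\<lambda>n. fst (fst (orbit n)))" and "y = (\<lambda>n. fst (snd (orbit n)))"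
  have o: "orbit n = window_of x y n" for n
  proof -
    have e: "n + 2 = n + 1 + 1" "n + 3 = n + 1 + 1 + 1" by simp_all
    show ?thesis
      unfolding x_def y_def window_of_def e orbit_step fwd_shift by simp
  qed
  have nz: "x n \<noteq> 0" for n
    using pos_window_orbit[of n] by (simp add: o window_of_def pos_ratfun_nonzero)
  have "window_of x y 0 = start" by (simp flip: o add: orbit_def)
  then have init: "x 0 = var X0 \<and> x 1 = var X1 \<and> x 2 = var X2 \<and> x 3 = var X3 \<and>
    y 0 = var Y0 \<and> y 1 = var Y1 \<and> y 2 = var Y2 \<and> y 3 = var Y3"
    by (simp add: window_of_def start_def)
  have "x (n + 4) * x n = var Alpha0 * x (n + 3) * x (n + 1) + var Beta0 * (x (n + 2))\<^sup>2 \<and>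
      x n * y (n + 4) - var Alpha0 * x (n + 1) * y (n + 3)
        - 2 * var Beta0 * x (n + 2) * y (n + 2)
        - var Alpha0 * x (n + 3) * y (n + 1) + x (n + 4) * y n
      = var Alpha1 * x (n + 1) * x (n + 3) + var Beta1 * (x (n + 2))\<^sup>2" for n
  proof -
    have "window_of x y (n + 1) = fwd (window_of x y n)" by (simp flip: o add: orbit_step)
    moreover have e: "n + 1 + 1 = n + 2" "n + 1 + 2 = n + 3" "n + 1 + 3 = n + 4" by simp_all
    ultimately have
      1: "x (n + 4) = (var Alpha0 * x (n + 3) * x (n + 1) + var Beta0 * (x (n + 2))\<^sup>2) / x n"
      and 2: "y (n + 4) = (var Alpha1 * x (n + 1) * x (n + 3) + var Beta1 * (x (n + 2))\<^sup>2
        + var Alpha0 * x (n + 1) * y (n + 3) + 2 * var Beta0 * x (n + 2) * y (n + 2)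
        + var Alpha0 * x (n + 3) * y (n + 1) - x (n + 4) * y n) / x n"
      unfolding window_of_def e by (simp_all add: Let_def)
    have 3: "x (n + 4) * x n = var Alpha0 * x (n + 3) * x (n + 1) + var Beta0 * (x (n + 2))\<^sup>2"
      using nz[of n] unfolding 1 by simp
    have "x n * y (n + 4) = var Alpha1 * x (n + 1) * x (n + 3) + var Beta1 * (x (n + 2))\<^sup>2
        + var Alpha0 * x (n + 1) * y (n + 3) + 2 * var Beta0 * x (n + 2) * y (n + 2)
        + var Alpha0 * x (n + 3) * y (n + 1) - x (n + 4) * y n"
      using nz[of n] unfolding 2 by simp
    then have "x n * y (n + 4) - var Alpha0 * x (n + 1) * y (n + 3)
        - 2 * var Beta0 * x (n + 2) * y (n + 2)
        - var Alpha0 * x (n + 3) * y (n + 1) + x (n + 4) * y n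
      = var Alpha1 * x (n + 1) * x (n + 3) + var Beta1 * (x (n + 2))\<^sup>2"
      by (simp add: algebra_simps)
    with 3 show ?thesis by blast
  qed
  then show ?thesis
    using init unfolding dual_somos4_iterates_def dual_somos4_def x_def[symmetric] y_def[symmetric]
    by blast
qed

lemma dual_somos4_iterates_ex1: "\<exists>!(x, y). dual_somos4_iterates x y"
proof (rule ex1I)
  show "case (\<lambda>n. fst (fst (orbit n)), \<lambda>n. fst (snd (orbit n))) of
      (x, y) \<Rightarrow> dual_somos4_iterates x y"
    by (simp add: dual_somos4_iterates_ex)
next
  fix xy assume "case xy of (x, y) \<Rightarrow> dual_somos4_iterates x y"
  then obtain x y where xy: "xy = (x, y)" and it: "dual_somos4_iterates x y" by auto
  show "xy = (\<lambda>n. fst (fst (orbit n)), \<lambda>n. fst (snd (orbit n)))"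
    by (simp add: xy fun_eq_iff window_of_def flip: window_of_eq_orbit[OF it])
qed

end

theory Submission
  imports Defs
begin

text \<open>
  For the dual numbers \<open>X\<^bsub>n\<^esub> = x\<^bsub>n\<^esub> + y\<^bsub>n\<^esub> \<epsilon>\<close> the system is the single Somos-4 recurrence
  \<open>X\<^bsub>n+4\<^esub> X\<^bsub>n\<^esub> = a X\<^bsub>n+3\<^esub> X\<^bsub>n+1\<^esub> + b X\<^bsub>n+2\<^esub>\<^sup>2\<close>, and the claim is that all \<open>X\<^bsub>n\<^esub>\<close> lie in a subring
  \<open>R\<close> that contains \<open>a\<close>, \<open>b\<close> and the inverses of the initial values. A Somos-4 sequence also
  satisfies \<open>X\<^bsub>n+5\<^esub> X\<^bsub>n\<^esub> = - b X\<^bsub>n+4\<^esub> X\<^bsub>n+1\<^esub> + c X\<^bsub>n+3\<^esub> X\<^bsub>n+2\<^esub>\<close> with a constant \<open>c \<in> R\<close>, so, inductively,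
  \<open>X\<^bsub>m\<^esub> X\<^bsub>m-4\<^esub>\<close> and \<open>X\<^bsub>m\<^esub> X\<^bsub>m-5\<^esub>\<close> are in \<open>R\<close>. The ideal generated by two consecutive terms contains
  a power of \<open>b\<close>: modulo it the recurrence kills \<open>b\<close> times the square of the preceding term, and
  one descends to a unit. Hence \<open>b\<^sup>N X\<^bsub>m\<^esub> \<in> R\<close>. Finally all terms are non-zero-divisors modulo
  \<open>b\<close>, because \<open>a\<close> is one (the coefficients are independent indeterminates) and the recurrence becomes multiplicative modulo \<open>b\<close>; as
  \<open>X\<^bsub>m\<^esub> X\<^bsub>m-4\<^esub> \<in> R\<close>, the factors \<open>b\<close> can be cancelled.
\<close>

section \<open>Somos-4 sequences in a commutative ring\<close>

locale subring_set =
  fixes R :: "'a::comm_ring_1 set"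
  assumes one_mem: "1 \<in> R"
    and diff_mem: "f \<in> R \<Longrightarrow> g \<in> R \<Longrightarrow> f - g \<in> R"
    and mult_mem: "f \<in> R \<Longrightarrow> g \<in> R \<Longrightarrow> f * g \<in> R"
begin

lemma zero_mem: "0 \<in> R"
  using diff_mem[OF one_mem one_mem] by simp

lemma minus_mem: "f \<in> R \<Longrightarrow> - f \<in> R"
  using diff_mem[OF zero_mem, of f] by simp

lemma add_mem: "f \<in> R \<Longrightarrow> g \<in> R \<Longrightarrow> f + g \<in> R"
  using diff_mem[OF _ minus_mem, of f g] by simp

lemma power_mem: "f \<in> R \<Longrightarrow> f ^ n \<in> R"
  by (induction n) (simp_all add: one_mem mult_mem)

lemmas closed = one_mem zero_mem diff_mem minus_mem add_mem mult_mem power_mem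

text \<open>For \<open>b\<close> and \<open>h\<close> in \<open>R\<close> this says that
  \<open>h\<close> is a non-zero-divisor in the quotient \<open>R / b R\<close>; it is spelled out
  by elements because \<open>R\<close> is a set inside a larger ring.\<close>

definition regular_mod :: "'a \<Rightarrow> 'a \<Rightarrow> bool" where
  "regular_mod b h \<longleftrightarrow> (\<forall>f\<in>R. \<forall>g\<in>R. h * f = b * g \<longrightarrow> (\<exists>f'\<in>R. f = b * f'))"

lemma regular_modD:
  assumes "regular_mod b h" "f \<in> R" "g \<in> R" "h * f = b * g"
  obtains f' where "f' \<in> R" "f = b * f'"
  using assms unfolding regular_mod_def by blast

lemma regular_mod_unit:
  assumes "v \<in> R" "h * v = 1"
  shows "regular_mod b h"
  unfolding regular_mod_def
proof (intro ballI impI)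
  fix f g assume "f \<in> R" "g \<in> R" and eq: "h * f = b * g"
  have "f = v * (h * f)"
    using assms(2) by (metis mult.assoc mult.commute mult_1)
  also have "\<dots> = b * (v * g)" unfolding eq by (rule mult.left_commute)
  finally have "f = b * (v * g)" .
  then show "\<exists>f'\<in>R. f = b * f'"
    using assms(1) \<open>g \<in> R\<close> mult_mem by blast
qed

lemma regular_mod_mult:
  assumes "regular_mod b h" "regular_mod b k" "k \<in> R"
  shows "regular_mod b (h * k)"
  unfolding regular_mod_def
proof (intro ballI impI)
  fix f g assume fg: "f \<in> R" "g \<in> R" and eq: "h * k * f = b * g"
  obtain f' where "f' \<in> R" "k * f = b * f'"
    using regular_modD[OF assms(1), of "k * f" g] fg eq assms(3) mult_mem
    by (metis mult.assoc)
  then show "\<exists>f'\<in>R. f = b * f'"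
    using regular_modD[OF assms(2) fg(1)] by metis
qed

text \<open>One factor \<open>b\<close> is removed at a time: \<open>h\<close> times
  \<open>b ^ Suc N * z\<close> is \<open>b\<close> times an element of \<open>R\<close>, so
  regularity gives \<open>b ^ Suc N * z = b * f\<close> with \<open>f\<close> in \<open>R\<close>,
  and \<open>b\<close> cancels in the ambient ring.\<close>

lemma mem_if_regular_mod:
  assumes cancel: "\<And>z. b * z = 0 \<Longrightarrow> z = 0" and "b \<in> R"
    and reg: "regular_mod b h" and hz: "h * z \<in> R" and "b ^ N * z \<in> R"
  shows "z \<in> R"
  using assms(5)
proof (induction N)
  case (Suc N)
  have "h * (b ^ Suc N * z) = b * (b ^ N * (h * z))"
    by (simp add: ac_simps)
  moreover have "b ^ N * (h * z) \<in> R"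
    using \<open>b \<in> R\<close> by (intro mult_mem[OF _ hz] closed)
  ultimately obtain f where f: "f \<in> R" "b ^ Suc N * z = b * f"
    using regular_modD[OF reg Suc.prems] by metis
  then have "b * (b ^ N * z - f) = 0" by (simp add: algebra_simps)
  then have "b ^ N * z = f" using cancel by (metis eq_iff_diff_eq_0)
  with f(1) show ?case using Suc.IH by simp
qed simp

end

text \<open>Cancellation is assumed instead of a field, since the ambient ring will be that of dual
  numbers. Indices are natural numbers; each direction of the integer sequence is a separate
  instance.\<close>

locale somos4 = subring_set R for R :: "'a::comm_ring_1 set" +
  fixes a b :: 'a and X :: "nat \<Rightarrow> 'a"
  assumes a_mem: "a \<in> R" and b_mem: "b \<in> R"
    and b_cancel: "b * z = 0 \<Longrightarrow> z = 0"
    and X_cancel: "X n * z = 0 \<Longrightarrow> z = 0"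
    and a_regular: "regular_mod b a"
    and initial_mem: "n < 4 \<Longrightarrow> X n \<in> R"
    and initial_unit: "n < 4 \<Longrightarrow> \<exists>v\<in>R. X n * v = 1"
    and recurrence: "X (n + 4) * X n = a * X (n + 3) * X (n + 1) + b * (X (n + 2))\<^sup>2"
begin

section \<open>Membership and regularity of the terms\<close>

lemma mem_of_initial_mult:
  assumes "n < 4" "z * X n \<in> R"
  shows "z \<in> R"
proof -
  obtain v where v: "v \<in> R" "X n * v = 1" using initial_unit[OF assms(1)] by blast
  have "z = z * X n * v" using v(2) by (simp add: mult.assoc)
  then show ?thesis using assms(2) v(1) mult_mem by metis
qed

lemma X4_mem: "X 4 \<in> R" and X5_mem: "X 5 \<in> R"
proof -
  have "X 4 * X 0 = a * X 3 * X 1 + b * (X 2)\<^sup>2"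
    using recurrence[of 0] by (simp only: add_0)
  also have "\<dots> \<in> R" by (intro closed a_mem b_mem initial_mem) simp_all
  finally show X4: "X 4 \<in> R" by (rule mem_of_initial_mult[rotated]) simp
  have "X 5 * X 1 = a * X 4 * X 2 + b * (X 3)\<^sup>2"
    using recurrence[of 1] by (simp only: numeral_plus_one one_plus_numeral semiring_norm one_add_one)
  also have "\<dots> \<in> R" by (intro closed a_mem b_mem X4 initial_mem) simp_all
  finally show "X 5 \<in> R" by (rule mem_of_initial_mult[rotated]) simp
qed

text \<open>The quotient of \<open>K n\<close> by \<open>X (n + 3) * X (n + 2)\<close> is a
  conserved quantity. At \<open>n = 0\<close> the divisors are the units \<open>X 3\<close> and
  \<open>X 2\<close>, so its value \<open>c\<close> lies in \<open>R\<close>.\<close>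

lemma somos5:
  obtains c where "c \<in> R"
    "\<And>n. X (n + 5) * X n + b * X (n + 4) * X (n + 1) = c * X (n + 3) * X (n + 2)"
proof -
  define K where "K n = X (n + 5) * X n + b * X (n + 4) * X (n + 1)" for n
  have K_Suc: "X (n + 2) * K (Suc n) = X (n + 4) * K n" for n
  proof -
    have 1: "X (n + 4) * X n = a * X (n + 3) * X (n + 1) + b * (X (n + 2))\<^sup>2"
      by (rule recurrence)
    have 2: "X (n + 6) * X (n + 2) = a * X (n + 5) * X (n + 3) + b * (X (n + 4))\<^sup>2"
      using recurrence[of "n + 2"] by (simp only: add.assoc numeral_plus_one numeral_plus_numeral semiring_norm)
    have e: "Suc n + 5 = n + 6" "Suc n + 4 = n + 5" "Suc n + 1 = n + 2" "Suc n = n + 1"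
      by simp_all
    have "X (n + 2) * K (Suc n) = (X (n + 6) * X (n + 2)) * X (n + 1) + b * X (n + 5) * (X (n + 2))\<^sup>2"
      unfolding K_def e by (simp add: algebra_simps power2_eq_square)
    \<comment> \<open>After expanding \<open>X (n + 6) * X (n + 2)\<close>, the terms with factor
      \<open>X (n + 5)\<close> reassemble to the right side of the recurrence at
      \<open>n\<close>.\<close>
    also have "\<dots> = X (n + 5) * (X (n + 4) * X n) + b * X (n + 4) * X (n + 4) * X (n + 1)"
      unfolding 1 2 by (simp add: algebra_simps power2_eq_square)
    also have "\<dots> = X (n + 4) * K n"
      unfolding K_def by (simp add: algebra_simps)
    finally show ?thesis .
  qed
  obtain v2 v3 where v: "v2 \<in> R" "X 2 * v2 = 1" "v3 \<in> R" "X 3 * v3 = 1"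
    using initial_unit[of 2] initial_unit[of 3] by auto
  define c where "c = K 0 * v2 * v3"
  have "c \<in> R"
    unfolding c_def K_def using v
    by (auto intro!: closed X4_mem X5_mem b_mem initial_mem)
  moreover have "K n = c * X (n + 3) * X (n + 2)" for n
  proof (induction n)
    case 0
    have "c * X (0 + 3) * X (0 + 2) = K 0 * (X 2 * v2) * (X 3 * v3)"
      by (simp only: c_def add_0 ac_simps)
    then show ?case using v(2,4) by simp
  next
    case (Suc n)
    have "X (n + 2) * (K (Suc n) - c * X (n + 4) * X (n + 3)) = 0"
      unfolding right_diff_distrib K_Suc Suc.IH by (simp add: algebra_simps)
    then have "K (Suc n) = c * X (n + 4) * X (n + 3)"
      using X_cancel by (metis eq_iff_diff_eq_0)
    then show ?case by (simp add: eval_nat_numeral)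
  qed
  ultimately show thesis using that unfolding K_def by blast
qed

text \<open>The recurrence expresses \<open>b\<close> times the square of the preceding term through
  the two given ones, so the pair of indices moves down by one at the cost of powers of
  \<open>b\<close>, until a unit among the initial terms is met.\<close>

lemma descent:
  assumes "\<And>j. j \<le> Suc k \<Longrightarrow> X j \<in> R" "z * X k \<in> R" "z * X (Suc k) \<in> R"
  shows "\<exists>N. b ^ N * z \<in> R"
  using assms
proof (induction k arbitrary: z)
  case 0
  then have "b ^ 0 * z \<in> R" using mem_of_initial_mult[of 0 z] by simp
  then show ?case by blast
next
  case (Suc k)
  note mem = Suc.prems(1)
  have IH: "\<exists>N. b ^ N * z' \<in> R" if "z' * X k \<in> R" "z' * X (Suc k) \<in> R" for z'
    using Suc.IH[OF _ that] mem by simp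
  show ?case
  proof (cases "Suc k < 4")
    case True
    then have "b ^ 0 * z \<in> R" using mem_of_initial_mult[OF True Suc.prems(2)] by simp
    then show ?thesis by blast
  next
    case False
    then have "k = k - 2 + 2" by simp
    then obtain i where k: "k = i + 2" by blast
    have "b * z * X k * X k = X i * (z * X (i + 4)) - a * X (i + 1) * (z * X (i + 3))"
      using arg_cong[OF recurrence, of "(*) z" i] unfolding k
      by (simp add: algebra_simps power2_eq_square)
    also have "\<dots> \<in> R"
    proof -
      have "z * X (i + 3) \<in> R" "z * X (i + 4) \<in> R"
        using Suc.prems(2,3) unfolding k by (simp_all add: eval_nat_numeral)
      moreover have "X i \<in> R" "a * X (i + 1) \<in> R"
        using mem k a_mem by (auto intro!: mult_mem)
      ultimately show ?thesis by (metis diff_mem mult_mem)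
    qed
    finally have 1: "b * z * X k * X k \<in> R" .
    have zk: "b ^ N * z * X (Suc k) \<in> R" for N
      using Suc.prems(2) b_mem by (simp add: mult.assoc closed)
    have "b * z * X k * X (Suc k) = X k * (b ^ 1 * z * X (Suc k))"
      by (simp add: ac_simps)
    also have "\<dots> \<in> R" by (intro closed zk mem) simp
    \<comment> \<open>Only the square of \<open>X k\<close> is controlled, so the induction
      hypothesis is used twice: first for \<open>b * z * X k\<close>, which removes one factor
      \<open>X k\<close>, then for \<open>b ^ Suc N * z\<close>.\<close>
    finally obtain N where N: "b ^ N * (b * z * X k) \<in> R" using IH[OF 1] by blast
    then have "b ^ Suc N * z * X k \<in> R" by (simp only: power_Suc ac_simps)
    from IH[OF this zk] obtain M where "b ^ M * (b ^ Suc N * z) \<in> R" by blast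
    then have "b ^ (M + Suc N) * z \<in> R" by (simp only: power_add mult.assoc)
    then show ?thesis by blast
  qed
qed

text \<open>Both claims share one strong induction: membership of \<open>X m\<close> cancels powers
  of \<open>b\<close> using regularity of \<open>X (m - 4)\<close>, and regularity of
  \<open>X m\<close> uses both claims for earlier terms.\<close>

lemma X_mem_regular: "X m \<in> R \<and> regular_mod b (X m)"
proof (induction m rule: less_induct)
  case (less m)
  show ?case
  proof (cases "m < 4")
    case True
    then show ?thesis
      using initial_mem initial_unit regular_mod_unit by blast
  next
    case False
    then obtain k where m: "m = k + 4" by (metis add.commute le_Suc_ex not_less)
    have step: "X (k + 4) * X k = a * X (k + 3) * X (k + 1) + b * (X (k + 2))\<^sup>2"
      by (rule recurrence)
    have IH: "X j \<in> R" "regular_mod b (X j)" if "j < k + 4" for j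
      using less.IH that m by blast+
    have prod_mem: "X (k + 4) * X k \<in> R"
      unfolding step using IH a_mem b_mem by (intro closed) simp_all
    have "X m \<in> R"
    proof (cases k)
      case 0
      then show ?thesis using m X4_mem by simp
    next
      case (Suc i)
      obtain c where c: "c \<in> R"
        "X (i + 5) * X i + b * X (i + 4) * X (i + 1) = c * X (i + 3) * X (i + 2)"
        using somos5 by metis
      have mi: "m = i + 5" using m Suc by simp
      have "X m * X i = c * X (i + 3) * X (i + 2) - b * X (i + 4) * X (i + 1)"
        using c(2) unfolding mi by (metis add_diff_cancel_right')
      also have "\<dots> \<in> R"
        using IH Suc b_mem c(1) by (intro closed) simp_all
      finally have 1: "X m * X i \<in> R" .
      have 2: "X m * X (Suc i) \<in> R" using prod_mem m Suc by simp
      obtain N where "b ^ N * X m \<in> R"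
        using descent[OF _ 1 2] IH Suc by auto
      moreover have "X k * X m \<in> R" using prod_mem m by (simp add: mult.commute)
      ultimately show ?thesis
        using mem_if_regular_mod[OF b_cancel b_mem] IH(2)[of k] by simp
    qed
    moreover have "regular_mod b (X m)"
      unfolding regular_mod_def
    proof (intro ballI impI)
      fix f g assume fg: "f \<in> R" "g \<in> R" and eq: "X m * f = b * g"
      \<comment> \<open>Modulo \<open>b\<close> the recurrence reads
        \<open>X m * X k = a * X (k + 3) * X (k + 1)\<close>, so whatever \<open>X m\<close> kills
        is killed by a product of regular elements.\<close>
      have "regular_mod b (a * X (k + 3) * X (k + 1))"
        using IH a_mem by (intro regular_mod_mult a_regular closed) simp_all
      moreover have "a * X (k + 3) * X (k + 1) * f = b * (X k * g - (X (k + 2))\<^sup>2 * f)"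
      proof -
        have "a * X (k + 3) * X (k + 1) * f = (X (k + 4) * X k - b * (X (k + 2))\<^sup>2) * f"
          unfolding step by simp
        also have "\<dots> = X k * (X m * f) - b * (X (k + 2))\<^sup>2 * f"
          unfolding m by (simp add: algebra_simps)
        finally show ?thesis unfolding eq by (simp add: algebra_simps)
      qed
      moreover have "X k * g - (X (k + 2))\<^sup>2 * f \<in> R"
        using IH fg by (intro closed) simp_all
      ultimately show "\<exists>f'\<in>R. f = b * f'"
        using fg(1) unfolding regular_mod_def by blast
    qed
    ultimately show ?thesis ..
  qed
qed

end

section \<open>Laurent polynomials\<close>

lemma subring_set_int_adjoin: "subring_set (int_adjoin S)"
  by unfold_locales (auto intro: int_adjoin.intros)

lemma int_adjoin_mono: "S \<subseteq> S' \<Longrightarrow> f \<in> int_adjoin S \<Longrightarrow> f \<in> int_adjoin S'"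
  by (rotate_tac, induction rule: int_adjoin.induct) (auto intro: int_adjoin.intros)

lemma subring_set_int_laurent: "subring_set (int_laurent S T)"
  unfolding int_laurent_def by (rule subring_set_int_adjoin)

lemma int_laurent_mono: "S \<subseteq> S' \<Longrightarrow> f \<in> int_laurent S T \<Longrightarrow> f \<in> int_laurent S' T"
  unfolding int_laurent_def by (rule int_adjoin_mono) auto

lemma int_laurent_gen:
  "s \<in> S \<Longrightarrow> s \<in> int_laurent S T"
  "t \<in> T \<Longrightarrow> t \<in> int_laurent S T"
  "t \<in> T \<Longrightarrow> inverse t \<in> int_laurent S T"
  unfolding int_laurent_def by (auto intro: int_adjoin.gen)

text \<open>Splits off the part without \<open>b\<close>, by induction on the generation of the
  ring; uniqueness of the splitting is not claimed.\<close>

lemma int_laurent_insert_decomp: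
  assumes "f \<in> int_laurent (insert b S) T"
  obtains f0 f1 where "f0 \<in> int_laurent S T" "f1 \<in> int_laurent (insert b S) T" "f = f0 + b * f1"
proof -
  interpret S: subring_set "int_laurent S T" by (rule subring_set_int_laurent)
  interpret bS: subring_set "int_laurent (insert b S) T" by (rule subring_set_int_laurent)
  have incl: "g \<in> int_laurent S T \<Longrightarrow> g \<in> int_laurent (insert b S) T" for g
    by (rule int_laurent_mono[rotated]) auto
  have b: "b \<in> int_laurent (insert b S) T" by (simp add: int_laurent_gen)
  have "\<exists>f0\<in>int_laurent S T. \<exists>f1\<in>int_laurent (insert b S) T. f = f0 + b * f1"
    using assms unfolding int_laurent_def[of "insert b S" T]
  proof (induction rule: int_adjoin.induct)
    case (gen s)
    show ?case
    proof (cases "s = b")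
      case True
      then show ?thesis
        using S.zero_mem bS.one_mem unfolding int_laurent_def[of "insert b S" T]
        by (intro bexI[of _ 0] bexI[of _ 1]) simp_all
    next
      case False
      then have "s \<in> int_laurent S T" using gen by (auto intro: int_laurent_gen)
      then show ?thesis
        using bS.zero_mem unfolding int_laurent_def[of "insert b S" T]
        by (intro bexI[of _ s] bexI[of _ 0]) simp_all
    qed
  next
    case one
    show ?case
      using S.one_mem bS.zero_mem unfolding int_laurent_def[of "insert b S" T]
      by (intro bexI[of _ 1] bexI[of _ 0]) simp_all
  next
    case (diff f g)
    then obtain f0 f1 g0 g1 where
      *: "f0 \<in> int_laurent S T" "g0 \<in> int_laurent S T"
      "f1 \<in> int_laurent (insert b S) T" "g1 \<in> int_laurent (insert b S) T"
      "f = f0 + b * f1" "g = g0 + b * g1"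
      unfolding int_laurent_def[of "insert b S" T] by blast
    have "f - g = (f0 - g0) + b * (f1 - g1)"
      unfolding * by (simp add: algebra_simps)
    then show ?case
      using S.diff_mem[OF *(1,2)] bS.diff_mem[OF *(3,4)]
      unfolding int_laurent_def[of "insert b S" T] by blast
  next
    case (mult f g)
    then obtain f0 f1 g0 g1 where
      *: "f0 \<in> int_laurent S T" "g0 \<in> int_laurent S T"
      "f1 \<in> int_laurent (insert b S) T" "g1 \<in> int_laurent (insert b S) T"
      "f = f0 + b * f1" "g = g0 + b * g1"
      unfolding int_laurent_def[of "insert b S" T] by blast
    have "f * g = f0 * g0 + b * (f0 * g1 + f1 * g0 + b * f1 * g1)"
      unfolding * by (simp add: algebra_simps)
    moreover have "f0 * g1 + f1 * g0 + b * f1 * g1 \<in> int_laurent (insert b S) T"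
      using * incl b by (intro bS.closed) auto
    ultimately show ?case
      using S.mult_mem[OF *(1,2)]
      unfolding int_laurent_def[of "insert b S" T] by blast
  qed
  then show thesis using that by blast
qed

section \<open>Rational functions and their dependence on one indeterminate\<close>

definition free_of :: "indet \<Rightarrow> int_mpoly \<Rightarrow> bool" where
  "free_of v p \<longleftrightarrow> (\<forall>k\<in>Poly_Mapping.keys p. Poly_Mapping.lookup k v = 0)"

text \<open>This is the subfield generated by the other indeterminates: some representing fraction
  avoids \<open>v\<close>, though others may contain it.\<close>

definition free_fract :: "indet \<Rightarrow> ratfun \<Rightarrow> bool" where
  "free_fract v f \<longleftrightarrow> (\<exists>p q. free_of v p \<and> free_of v q \<and> q \<noteq> 0 \<and> f = Fract p q)"

lemma free_of_diff: "free_of v p \<Longrightarrow> free_of v q \<Longrightarrow> free_of v (p - q)"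
  unfolding free_of_def using keys_diff[of p q] by blast

lemma free_of_mult:
  assumes "free_of v p" "free_of v q"
  shows "free_of v (p * q)"
  unfolding free_of_def
proof
  fix k assume "k \<in> Poly_Mapping.keys (p * q)"
  then obtain i j where "k = i + j" "i \<in> Poly_Mapping.keys p" "j \<in> Poly_Mapping.keys q"
    using keys_mult[of p q] by blast
  then show "Poly_Mapping.lookup k v = 0"
    using assms unfolding free_of_def by (simp add: lookup_add)
qed

lemma free_of_single:
  "Poly_Mapping.lookup k v = 0 \<Longrightarrow> free_of v (Poly_Mapping.single k c)"
  unfolding free_of_def by simp

lemma free_of_one: "free_of v 1"
  using free_of_single[of 0 v 1] by simp

lemma free_fract_var: "w \<noteq> v \<Longrightarrow> free_fract v (var w)"
  unfolding free_fract_def var_def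
  by (intro exI conjI; (rule refl)?) (simp_all add: free_of_single free_of_one lookup_single)

lemma free_fract_one: "free_fract v 1"
  unfolding free_fract_def One_fract_def using free_of_one by (metis zero_neq_one)

lemma free_fract_diff:
  assumes "free_fract v f" "free_fract v g"
  shows "free_fract v (f - g)"
proof -
  obtain p q where f: "free_of v p" "free_of v q" "q \<noteq> 0" "f = Fract p q"
    using assms(1) unfolding free_fract_def by blast
  obtain r s where g: "free_of v r" "free_of v s" "s \<noteq> 0" "g = Fract r s"
    using assms(2) unfolding free_fract_def by blast
  have "f - g = Fract (p * s - r * q) (q * s)"
    using f g by simp
  then show ?thesis
    using f g unfolding free_fract_def
    by (intro exI[of _ "p * s - r * q"] exI[of _ "q * s"]) (simp add: free_of_mult free_of_diff)
qed

lemma free_fract_mult: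
  assumes "free_fract v f" "free_fract v g"
  shows "free_fract v (f * g)"
proof -
  obtain p q where f: "free_of v p" "free_of v q" "q \<noteq> 0" "f = Fract p q"
    using assms(1) unfolding free_fract_def by blast
  obtain r s where g: "free_of v r" "free_of v s" "s \<noteq> 0" "g = Fract r s"
    using assms(2) unfolding free_fract_def by blast
  have "f * g = Fract (p * r) (q * s)"
    using f g by simp
  then show ?thesis
    using f g unfolding free_fract_def
    by (intro exI[of _ "p * r"] exI[of _ "q * s"]) (simp add: free_of_mult)
qed

lemma free_fract_inverse: "free_fract v f \<Longrightarrow> free_fract v (inverse f)"
proof -
  assume "free_fract v f"
  then obtain p q where pq: "free_of v p" "free_of v q" "q \<noteq> 0" "f = Fract p q"
    unfolding free_fract_def by blast
  show ?thesis
  \<comment> \<open>Swapping numerator and denominator needs \<open>p\<close> nonzero; otherwise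
    \<open>f\<close> is 0, which is its own inverse by convention.\<close>
  proof (cases "p = 0")
    case True
    then have "inverse f = f" using pq(4) by (simp add: fract_collapse)
    then show ?thesis using \<open>free_fract v f\<close> by simp
  next
    case False
    then show ?thesis
      using pq unfolding free_fract_def by (intro exI[of _ q] exI[of _ p]) simp
  qed
qed

lemma free_fract_int_laurent:
  assumes "f \<in> int_laurent (var ` A) (var ` B)" "v \<notin> A" "v \<notin> B"
  shows "free_fract v f"
  using assms(1) unfolding int_laurent_def
proof (induction rule: int_adjoin.induct)
  case (gen s)
  then show ?case using assms(2,3) by (auto intro!: free_fract_var free_fract_inverse)
qed (simp_all add: free_fract_one free_fract_diff free_fract_mult)

text \<open>Elements \<open>P / Q\<close> with \<open>P\<close> arbitrary and \<open>Q\<close> free of \<open>v\<close> are the ones without pole at \<open>v = 0\<close>.\<close>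

definition no_pole :: "indet \<Rightarrow> ratfun \<Rightarrow> bool" where
  "no_pole v f \<longleftrightarrow> (\<exists>p q. free_of v q \<and> q \<noteq> 0 \<and> f = Fract p q)"

lemma no_pole_diff:
  assumes "no_pole v f" "no_pole v g"
  shows "no_pole v (f - g)"
proof -
  obtain p q where f: "free_of v q" "q \<noteq> 0" "f = Fract p q"
    using assms(1) unfolding no_pole_def by blast
  obtain r s where g: "free_of v s" "s \<noteq> 0" "g = Fract r s"
    using assms(2) unfolding no_pole_def by blast
  have "f - g = Fract (p * s - r * q) (q * s)"
    using f g by simp
  then show ?thesis
    using f g unfolding no_pole_def
    by (intro exI[of _ "p * s - r * q"] exI[of _ "q * s"]) (simp add: free_of_mult)
qed

lemma no_pole_mult:
  assumes "no_pole v f" "no_pole v g"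
  shows "no_pole v (f * g)"
proof -
  obtain p q where f: "free_of v q" "q \<noteq> 0" "f = Fract p q"
    using assms(1) unfolding no_pole_def by blast
  obtain r s where g: "free_of v s" "s \<noteq> 0" "g = Fract r s"
    using assms(2) unfolding no_pole_def by blast
  have "f * g = Fract (p * r) (q * s)"
    using f g by simp
  then show ?thesis
    using f g unfolding no_pole_def
    by (intro exI[of _ "p * r"] exI[of _ "q * s"]) (simp add: free_of_mult)
qed

lemma no_pole_var: "no_pole v (var w)"
  unfolding no_pole_def var_def using free_of_one by (metis zero_neq_one)

lemma no_pole_free: "free_fract v f \<Longrightarrow> no_pole v f"
  unfolding free_fract_def no_pole_def by blast

lemma no_pole_int_laurent:
  assumes "f \<in> int_laurent (var ` A) (var ` B)" "v \<notin> B"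
  shows "no_pole v f"
  using assms(1) unfolding int_laurent_def
proof (induction rule: int_adjoin.induct)
  case (gen s)
  then consider w where "s = var w" | w where "w \<in> B" "s = inverse (var w)" by blast
  then show ?case
  proof cases
    case 2
    then have "w \<noteq> v" using assms(2) by blast
    then show ?thesis using 2 by (simp add: no_pole_free free_fract_var free_fract_inverse)
  qed (simp add: no_pole_var)
qed (simp_all add: no_pole_free free_fract_one no_pole_diff no_pole_mult)

text \<open>Every monomial of a multiple of \<open>v\<close> contains \<open>v\<close>, so
  \<open>p\<close> has no monomials.\<close>

lemma free_of_eq_var_mult:
  assumes "free_of v p" "p = Poly_Mapping.single (Poly_Mapping.single v 1) 1 * q"
  shows "p = 0"
proof -
  have "Poly_Mapping.lookup k v \<noteq> 0" if "k \<in> Poly_Mapping.keys p" for k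
    using that keys_mult[of "Poly_Mapping.single (Poly_Mapping.single v 1) 1" q]
    unfolding assms(2) by (force simp: lookup_add lookup_single)
  then have "Poly_Mapping.keys p = {}"
    using assms(1) unfolding free_of_def by blast
  then show ?thesis by simp
qed

lemma free_fract_eq_var_mult:
  assumes "free_fract v f" "no_pole v g" "f = var v * g"
  shows "f = 0"
proof -
  let ?v = "Poly_Mapping.single (Poly_Mapping.single v 1) 1 :: int_mpoly"
  obtain p q where f: "free_of v p" "q \<noteq> 0" "f = Fract p q"
    using assms(1) unfolding free_fract_def by blast
  obtain r s where g: "free_of v s" "s \<noteq> 0" "g = Fract r s"
    using assms(2) unfolding no_pole_def by blast
  have "p * s = ?v * (r * q)"
    using assms(3) f g by (simp add: var_def eq_fract mult.assoc)
  then have "p * s = 0"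
    using free_of_eq_var_mult free_of_mult f(1) g(1) by blast
  then show ?thesis using f g by (simp add: fract_collapse)
qed

lemma var_nonzero: "var v \<noteq> 0"
  using pos_ratfun_var pos_ratfun_nonzero by blast

text \<open>Independence of the indeterminates enters here. With \<open>f = f0 + var v * f1\<close>,
  the product \<open>var w * f0\<close> does not involve \<open>v\<close>, yet it is
  \<open>var v\<close> times an element without pole at \<open>v = 0\<close>; hence
  \<open>f0 = 0\<close>.\<close>

lemma regular_mod_var:
  assumes "w \<in> A" "v \<notin> A" "v \<notin> B"
  shows "subring_set.regular_mod (int_laurent (insert (var v) (var ` A)) (var ` B)) (var v) (var w)"
proof -
  let ?L = "int_laurent (insert (var v) (var ` A)) (var ` B)"
  interpret subring_set ?L by (rule subring_set_int_laurent)
  show ?thesis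
    unfolding regular_mod_def
  proof (intro ballI impI)
    fix f g assume f: "f \<in> ?L" and g: "g \<in> ?L" and eq: "var w * f = var v * g"
    obtain f0 f1 where *: "f0 \<in> int_laurent (var ` A) (var ` B)" "f1 \<in> ?L" "f = f0 + var v * f1"
      using int_laurent_insert_decomp[OF f] .
    have w: "var w \<in> ?L" using assms(1) by (simp add: int_laurent_gen)
    have "var w * f0 = var v * (g - var w * f1)"
      using eq unfolding *(3) by (simp add: algebra_simps)
    moreover have "g - var w * f1 \<in> int_laurent (var ` insert v A) (var ` B)"
      using closed g w *(2) by simp
    then have "no_pole v (g - var w * f1)"
      by (rule no_pole_int_laurent) (rule assms)
    moreover have "free_fract v (var w * f0)"
      using assms free_fract_int_laurent[OF *(1)] by (intro free_fract_mult free_fract_var) auto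
    ultimately have "var w * f0 = 0" using free_fract_eq_var_mult by blast
    then have "f0 = 0" by (simp add: var_nonzero)
    with * show "\<exists>f'\<in>?L. f = var v * f'" by auto
  qed
qed

section \<open>Dual numbers\<close>

text \<open>\<open>Dual f g\<close> stands for f + g \<epsilon> with \<epsilon> squared equal to
  0.\<close>

datatype 'a dual = Dual 'a 'a

instantiation dual :: (comm_ring_1) comm_ring_1
begin

definition "0 = Dual 0 0"
definition "1 = Dual 1 0"

fun plus_dual where "Dual f g + Dual p q = Dual (f + p) (g + q)"
fun minus_dual where "Dual f g - Dual p q = Dual (f - p) (g - q)"
fun uminus_dual where "- Dual f g = Dual (- f) (- g)"
fun times_dual where "Dual f g * Dual p q = Dual (f * p) (f * q + g * p)"

instance
proof
  fix x y z :: "'a dual"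
  obtain f g p q r s where "x = Dual f g" "y = Dual p q" "z = Dual r s"
    by (metis dual.exhaust)
  note * = this zero_dual_def one_dual_def
  show "x + y + z = x + (y + z)" "x + y = y + x" "0 + x = x" "- x + x = 0" "x - y = x + - y"
    "x * y * z = x * (y * z)" "x * y = y * x" "1 * x = x" "(x + y) * z = x * z + y * z"
    "(0::'a dual) \<noteq> 1"
    by (simp_all add: * algebra_simps)
qed

end

lemma dual_cancel:
  fixes f g :: "'a::idom"
  assumes "f \<noteq> 0" "Dual f g * z = 0"
  shows "z = 0"
  using assms by (cases z) (simp add: zero_dual_def)

text \<open>The components get separate rings because the claim for \<open>x\<close> allows fewer
  generators than the one for \<open>y\<close>.\<close>

definition dual_set :: "'a set \<Rightarrow> 'a set \<Rightarrow> 'a dual set" where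
  "dual_set L M = {Dual f g | f g. f \<in> L \<and> g \<in> M}"

lemma Dual_mem_dual_set [simp]: "Dual f g \<in> dual_set L M \<longleftrightarrow> f \<in> L \<and> g \<in> M"
  by (simp add: dual_set_def)

lemma subring_set_dual_set:
  assumes "subring_set L" "subring_set M" "L \<subseteq> M"
  shows "subring_set (dual_set L M)"
proof -
  interpret L: subring_set L by fact
  interpret M: subring_set M by fact
  show ?thesis
  proof
    show "1 \<in> dual_set L M" by (simp add: one_dual_def L.one_mem M.zero_mem)
  next
    fix x y assume "x \<in> dual_set L M" "y \<in> dual_set L M"
    then show "x - y \<in> dual_set L M" "x * y \<in> dual_set L M"
      using assms(3) by (auto simp: dual_set_def intro!: L.closed M.closed)
  qed
qed

text \<open>Division is done one component at a time: regularity over \<open>L\<close> gives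
  \<open>f = b0 * f'\<close>, and substituting this turns the \<epsilon>-component into an equation
  to which regularity over \<open>M\<close> applies.\<close>

lemma regular_mod_dual_set:
  fixes a0 b0 :: "'a::idom"
  assumes "subring_set L" "subring_set M" "L \<subseteq> M" "a0 \<in> L" "a1 \<in> M" "b1 \<in> M" "b0 \<noteq> 0"
    and "subring_set.regular_mod L b0 a0" "subring_set.regular_mod M b0 a0"
  shows "subring_set.regular_mod (dual_set L M) (Dual b0 b1) (Dual a0 a1)"
proof -
  interpret L: subring_set L by fact
  interpret M: subring_set M by fact
  interpret D: subring_set "dual_set L M" by (rule subring_set_dual_set) fact+
  show ?thesis
    unfolding D.regular_mod_def
  proof (intro ballI impI)
    fix x y assume "x \<in> dual_set L M" "y \<in> dual_set L M" and eq: "Dual a0 a1 * x = Dual b0 b1 * y"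
    then obtain f g p q where x: "x = Dual f g" "f \<in> L" "g \<in> M" and y: "y = Dual p q" "p \<in> L" "q \<in> M"
      by (auto simp: dual_set_def)
    have 1: "a0 * f = b0 * p" and 2: "a0 * g + a1 * f = b0 * q + b1 * p"
      using eq unfolding x y by simp_all
    obtain f' where f': "f' \<in> L" "f = b0 * f'"
      using L.regular_modD[OF assms(8) x(2) y(2) 1] .
    have p: "p = a0 * f'" using 1 f'(2) assms(7) by simp
    have "a0 * (g - b1 * f') = b0 * (q - a1 * f')"
      using 2 unfolding f'(2) p by (simp add: algebra_simps)
    moreover have "g - b1 * f' \<in> M" "q - a1 * f' \<in> M"
      using assms(3,5,6) f'(1) x(3) y(3) by (auto intro!: M.closed)
    ultimately obtain g' where g': "g' \<in> M" "g - b1 * f' = b0 * g'"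
      using M.regular_modD[OF assms(9)] by metis
    have "x = Dual b0 b1 * Dual f' g'"
      using f'(2) g'(2) unfolding x by (simp add: algebra_simps)
    then show "\<exists>z\<in>dual_set L M. x = Dual b0 b1 * z"
      using f'(1) g'(1) by (intro bexI[of _ "Dual f' g'"]) simp_all
  qed
qed

section \<open>The system as one recurrence over the dual numbers\<close>

lemma dual_somos4_Dual:
  assumes "dual_somos4 a0 a1 b0 b1 x y"
  shows "Dual (x (n + 4)) (y (n + 4)) * Dual (x n) (y n)
       = Dual a0 a1 * Dual (x (n + 3)) (y (n + 3)) * Dual (x (n + 1)) (y (n + 1))
         + Dual b0 b1 * (Dual (x (n + 2)) (y (n + 2)))\<^sup>2"
proof -
  have 1: "x (n + 4) * x n = a0 * x (n + 3) * x (n + 1) + b0 * (x (n + 2))\<^sup>2"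
    and 2: "x n * y (n + 4) - a0 * x (n + 1) * y (n + 3) - 2 * b0 * x (n + 2) * y (n + 2)
        - a0 * x (n + 3) * y (n + 1) + x (n + 4) * y n
      = a1 * x (n + 1) * x (n + 3) + b1 * (x (n + 2))\<^sup>2"
    using assms unfolding dual_somos4_def by blast+
  have "x (n + 4) * y n + y (n + 4) * x n
      = a0 * x (n + 3) * y (n + 1) + (a0 * y (n + 3) + a1 * x (n + 3)) * x (n + 1)
        + (b0 * (x (n + 2) * y (n + 2) + y (n + 2) * x (n + 2)) + b1 * (x (n + 2) * x (n + 2)))"
    using 2 by (simp add: algebra_simps power2_eq_square)
  with 1 show ?thesis by (simp add: power2_eq_square)
qed

theorem lemma1p1:
  fixes x y :: "int \<Rightarrow> ratfun"
  assumes "dual_somos4_iterates x y"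
  shows "\<forall>n::int.
    x n \<in> int_laurent {var Alpha0, var Beta0} {var X0, var X1, var X2, var X3} \<and>
    y n \<in> int_laurent
      {var Alpha0, var Alpha1, var Beta0, var Beta1, var Y0, var Y1, var Y2, var Y3}
      {var X0, var X1, var X2, var X3}"
proof -
  define B where "B = {X0, X1, X2, X3}"
  \<comment> \<open>\<open>Beta0\<close> is left out since it is the indeterminate modulo which
    regularity is shown; it is inserted separately.\<close>
  define A where "A = {Alpha0, Alpha1, Beta1, Y0, Y1, Y2, Y3}"
  define L where "L = int_laurent (insert (var Beta0) (var ` {Alpha0})) (var ` B)"
  define M where "M = int_laurent (insert (var Beta0) (var ` A)) (var ` B)"
  define X where "X n = Dual (x n) (y n)" for n
  define a where "a = Dual (var Alpha0) (var Alpha1)"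
  define b where "b = Dual (var Beta0) (var Beta1)"
  have L: "subring_set L" and M: "subring_set M"
    unfolding L_def M_def by (rule subring_set_int_laurent)+
  interpret L: subring_set L by (rule L)
  interpret M: subring_set M by (rule M)
  have "L \<subseteq> M"
    unfolding L_def M_def A_def by (auto intro: int_laurent_mono[rotated])
  interpret subring_set "dual_set L M" by (rule subring_set_dual_set) fact+
  have gen_L: "var v \<in> L" if "v \<in> {Alpha0, Beta0} \<union> B" for v
    using that unfolding L_def by (auto intro: int_laurent_gen)
  have gen_M: "var v \<in> M" if "v \<in> insert Beta0 A \<union> B" for v
    using that unfolding M_def by (auto intro: int_laurent_gen)
  have inv_L: "inverse (var v) \<in> L" if "v \<in> B" for v
    using that unfolding L_def by (auto intro: int_laurent_gen)
  have rec: "X (n + 4) * X n = a * X (n + 3) * X (n + 1) + b * (X (n + 2))\<^sup>2" for n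
    using assms unfolding dual_somos4_iterates_def X_def a_def b_def by (intro dual_somos4_Dual) blast
  have x_nonzero: "x n \<noteq> 0" for n
    using pos_window_orbit[of n]
    by (simp add: window_of_def pos_ratfun_nonzero flip: window_of_eq_orbit[OF assms])
  have initial: "\<exists>v w. v \<in> B \<and> w \<in> A \<and> X n = Dual (var v) (var w)" if "0 \<le> n" "n < 4" for n
  proof -
    have "n = 0 \<or> n = 1 \<or> n = 2 \<or> n = 3" using that by auto
    then show ?thesis
      using assms unfolding dual_somos4_iterates_def X_def A_def B_def by auto
  qed
  have initial_mem: "X n \<in> dual_set L M" if "0 \<le> n" "n < 4" for n
    using initial[OF that] gen_L gen_M by auto
  have initial_unit: "\<exists>v\<in>dual_set L M. X n * v = 1" if n: "0 \<le> n" "n < 4" for n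
  proof -
    obtain v w where vw: "v \<in> B" "w \<in> A" "X n = Dual (var v) (var w)" using initial[OF n] by blast
    let ?i = "inverse (var v)"
    \<comment> \<open>The inverse of u + w \<epsilon> is 1/u - (w/u^2) \<epsilon>, so no initial
      value of \<open>y\<close> is ever inverted.\<close>
    have "Dual ?i (- var w * ?i * ?i) \<in> dual_set L M"
      using vw inv_L gen_M \<open>L \<subseteq> M\<close> by (auto intro!: M.closed)
    moreover have "X n * Dual ?i (- var w * ?i * ?i) = 1"
      unfolding vw(3) by (simp add: one_dual_def var_nonzero)
    ultimately show ?thesis by blast
  qed
  have regular: "regular_mod b a"
    unfolding a_def b_def
  proof (rule regular_mod_dual_set[OF L M \<open>L \<subseteq> M\<close>])
    show "L.regular_mod (var Beta0) (var Alpha0)" "M.regular_mod (var Beta0) (var Alpha0)"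
      unfolding L_def M_def by (rule regular_mod_var; simp add: A_def B_def)+
  qed (simp_all add: gen_L gen_M A_def var_nonzero)
  have mem: "Z n \<in> dual_set L M"
    if "\<And>n. n < 4 \<Longrightarrow> \<exists>i. 0 \<le> i \<and> i < 4 \<and> Z n = X i" "\<And>n. \<exists>i. Z n = X i"
      "\<And>n. Z (n + 4) * Z n = a * Z (n + 3) * Z (n + 1) + b * (Z (n + 2))\<^sup>2" for Z :: "nat \<Rightarrow> _" and n
  proof -
    interpret somos4 "dual_set L M" a b Z
    proof
      show "a \<in> dual_set L M" "b \<in> dual_set L M"
        unfolding a_def b_def by (auto simp: gen_L gen_M A_def)
      show "b * z = 0 \<Longrightarrow> z = 0" for z
        unfolding b_def using dual_cancel var_nonzero by blast
      show "Z n * z = 0 \<Longrightarrow> z = 0" for n z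
        using that(2)[of n] dual_cancel x_nonzero unfolding X_def by metis
      show "regular_mod b a" by (rule regular)
      show "Z n \<in> dual_set L M" "\<exists>v\<in>dual_set L M. Z n * v = 1" if "n < 4" for n
        using \<open>\<And>n. n < 4 \<Longrightarrow> \<exists>i. 0 \<le> i \<and> i < 4 \<and> Z n = X i\<close>[OF that]
          initial_mem initial_unit by metis+
    qed (rule that(3))
    show ?thesis using X_mem_regular by blast
  qed
  have forward: "X (int n) \<in> dual_set L M" for n
  proof (rule mem[of "\<lambda>n. X (int n)"])
    show "\<exists>i\<ge>0. i < 4 \<and> X (int n) = X i" if "n < 4" for n
      using that by (intro exI[of _ "int n"]) simp
    show "X (int (n + 4)) * X (int n)
        = a * X (int (n + 3)) * X (int (n + 1)) + b * (X (int (n + 2)))\<^sup>2" for n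
      using rec[of "int n"] by (simp add: add.commute)
  qed blast
  \<comment> \<open>The reflection of indices at 3/2 permutes the initial indices 0 to 3 and
    preserves the recurrence, which is symmetric under reversal.\<close>
  have backward: "X (3 - int n) \<in> dual_set L M" for n
  proof (rule mem[of "\<lambda>n. X (3 - int n)"])
    show "\<exists>i\<ge>0. i < 4 \<and> X (3 - int n) = X i" if "n < 4" for n
      using that by (intro exI[of _ "3 - int n"]) simp
    show "X (3 - int (n + 4)) * X (3 - int n)
        = a * X (3 - int (n + 3)) * X (3 - int (n + 1)) + b * (X (3 - int (n + 2)))\<^sup>2" for n
    proof -
      define m where "m = - 1 - int n"
      have m: "3 - int (n + 4) = m" "3 - int (n + 3) = m + 1" "3 - int (n + 2) = m + 2"
        "3 - int (n + 1) = m + 3" "3 - int n = m + 4" by (simp_all add: m_def)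
      show ?thesis unfolding m using rec[of m] by (simp only: ac_simps)
    qed
  qed blast
  have "X n \<in> dual_set L M" for n
    using forward[of "nat n"] backward[of "nat (3 - n)"] by (cases "0 \<le> n") simp_all
  then show ?thesis
    unfolding X_def L_def M_def A_def B_def by (simp add: insert_commute)
qed

end
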